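(* Let $k\ge 2$ and $r\ge 3$ be integers. Suppose there is a constant $c>0$ such that for every sufficiently large integer $n$ there exists an $n$-vertex graph of girth more than $2k$ with $cn^{1+1/k}$ edges. Then there is a constant $c_{k,r}>0$, depending only on $k$ and $r$, such that for all sufficiently large $t$, \[ R(t,\mathcal{B}^r_{k}) \geq c_{k,r}\left(\frac{t}{\log t}\right)^{\frac{k}{k-1}}. \]
   Context: An $r$-graph is a hypergraph all of whose edges have size $r$. An independent set in a hypergraph is a set of vertices containing no edge. For $k\ge 2$, a Berge $k$-cycle is a family of sets $e_1,\dots,e_k$ such that the sets $e_1\cap e_2, e_2\cap e_3,\dots,e_{k-1}\cap e_k, e_k\cap e_1$ have a system of distinct representatives; it is non-trivial if $e_1\cap e_2\cap\dots\cap e_k=\emptyset$. $\mathcal{B}^r_k$ denotes the family of all non-trivial Berge $k$-cycles all of whose sets have size $r$. For a family $\mathcal{F}$ of $r$-graphs, $R(t,\mathcal{F})$ is the minimum $n$ such that every $n$-vertex $r$-graph contains either a member of $\mathcal{F}$ or an independent set of size $t$. Here $\log$ denotes the natural logarithm. *)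

theory Defs
  imports Complex_Main "HOL-Library.Extended_Real"
begin

definition uniform_hypergraph :: "nat \<Rightarrow> 'a set \<Rightarrow> 'a set set \<Rightarrow> bool" where
  "uniform_hypergraph r V E \<longleftrightarrow> finite V \<and> (\<forall>e\<in>E. e \<subseteq> V \<and> card e = r)"

definition independent_set :: "'a set \<Rightarrow> 'a set set \<Rightarrow> 'a set \<Rightarrow> bool" where
  "independent_set V E S \<longleftrightarrow> S \<subseteq> V \<and> (\<forall>e\<in>E. \<not> e \<subseteq> S)"

text \<open>A simple graph is a 2-uniform hypergraph. A graph without cycles has girth \<open>\<infinity>\<close>.\<close>

definition graph_cycle :: "'a set set \<Rightarrow> 'a list \<Rightarrow> bool" where
  "graph_cycle E xs \<longleftrightarrow> length xs \<ge> 3 \<and> distinct xs \<and>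
     (\<forall>i<length xs. {xs ! i, xs ! (Suc i mod length xs)} \<in> E)"

definition girth :: "'a set set \<Rightarrow> enat" where
  "girth E = Inf {enat (length xs) | xs. graph_cycle E xs}"

definition has_sdr :: "'i set \<Rightarrow> ('i \<Rightarrow> 'a set) \<Rightarrow> bool" where
  "has_sdr I A \<longleftrightarrow> (\<exists>v. inj_on v I \<and> (\<forall>i\<in>I. v i \<in> A i))"

text \<open>The sets are indexed by \<open>0, \<dots>, k - 1\<close> and, as usual for Berge cycles, pairwise distinct.\<close>

definition berge_cycle :: "nat \<Rightarrow> (nat \<Rightarrow> 'a set) \<Rightarrow> bool" where
  "berge_cycle k e \<longleftrightarrow> inj_on e {..<k} \<and> has_sdr {..<k} (\<lambda>i. e i \<inter> e (Suc i mod k))"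

definition nontrivial_berge_cycle :: "nat \<Rightarrow> (nat \<Rightarrow> 'a set) \<Rightarrow> bool" where
  "nontrivial_berge_cycle k e \<longleftrightarrow> berge_cycle k e \<and> (\<Inter>i<k. e i) = {}"

definition nontrivial_berge_cycles :: "nat \<Rightarrow> nat \<Rightarrow> nat set set set" where
  "nontrivial_berge_cycles r k =
     {e ` {..<k} | e. nontrivial_berge_cycle k e \<and> (\<forall>i<k. card (e i) = r)}"

text \<open>Forbidden hypergraphs are given by their edge sets, so they have no isolated vertices.
  Containment is up to isomorphism: some injective relabelling of the vertices maps every
  edge to an edge.\<close>

definition contains_member :: "'a set set \<Rightarrow> 'b set set set \<Rightarrow> bool" where
  "contains_member E \<F> \<longleftrightarrow> (\<exists>F\<in>\<F>. \<exists>f. inj_on f (\<Union>F) \<and> (\<forall>e\<in>F. f ` e \<in> E))"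

text \<open>The value is \<open>\<infinity>\<close> if there is no \<open>n\<close> with the required property. This happens for
  \<open>nontrivial_berge_cycles r 2\<close>, which is empty, as soon as \<open>t \<ge> r\<close>: complete hypergraphs then
  have no independent set of size \<open>t\<close>.\<close>

definition ramsey_number :: "nat \<Rightarrow> nat \<Rightarrow> nat set set set \<Rightarrow> enat" where
  "ramsey_number r t \<F> = Inf {enat n | n.
     \<forall>(V :: nat set) E. uniform_hypergraph r V E \<and> card V = n \<longrightarrow>
       contains_member E \<F> \<or> (\<exists>S. independent_set V E S \<and> card S = t)}"

end

theory Submission
  imports Defs "HOL-Library.FuncSet" "HOL-Library.Countable"
begin

text \<open>Start from a graph of girth greater than \<open>2k\<close> with \<open>n\<close> vertices and about \<open>n d\<close> edges,
  where \<open>d\<close> has order \<open>n\<^sup>1\<^sup>/\<^sup>k\<close>, regarded as a bipartite incidence structure on two copies of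
  its vertex set. Splitting vertices keeps the girth large, so on one side we may pass to \<open>n\<close>
  points of degree exactly \<open>d\<close>, and on the other side to cells of size at most
  \<open>s \<approx> d / (3 ln n)\<close>. Choose a centre in every cell independently and uniformly; the edges of
  the hypergraph are the \<open>r\<close>-subsets of cells containing the centre. A Berge \<open>k\<close>-cycle inside one
  cell is trivial because of the centre, and one that uses several cells yields a closed
  non-backtracking walk of length at most \<open>2k\<close> in the graph. A fixed \<open>t\<close>-set is independent with
  probability at most \<open>exp (- (t d - r m) / s)\<close>, where \<open>m\<close> is the number of cells. Since \<open>d / s\<close> is
  of order \<open>ln n\<close>, this beats the number \<open>n\<^sup>t\<close> of candidates as soon as \<open>t\<close> is at least a
  constant times \<open>n\<^sup>1\<^sup>-\<^sup>1\<^sup>/\<^sup>k ln n\<close>. Without the splitting into small cells a factor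
  \<open>ln n\<close> in the exponent would be missing.\<close>

section \<open>Closed walks, cycles and girth\<close>

lemma girth_le: "graph_cycle E xs \<Longrightarrow> girth E \<le> enat (length xs)"
  unfolding girth_def by (rule Inf_lower) blast

text \<open>A shortest segment with equal ends is a cycle: lengths 1 and 2 are excluded by
  \<open>noloop\<close> and \<open>nonback\<close>, and a repetition inside it would give a shorter
  such segment. Backtracking is excluded only inside the walk, not across the junction of
  \<open>w L\<close> with \<open>w 0\<close>, because the segment is read off between two indices of
  the unrolled walk.\<close>

lemma nonbacktracking_closed_walk_cycle:
  fixes w :: "nat \<Rightarrow> 'a"
  assumes edge: "\<And>i. i < L \<Longrightarrow> {w i, w (Suc i)} \<in> E"
    and noloop: "\<And>i. i < L \<Longrightarrow> w i \<noteq> w (Suc i)"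
    and nonback: "\<And>i. Suc (Suc i) \<le> L \<Longrightarrow> w i \<noteq> w (Suc (Suc i))"
    and closed: "w 0 = w L" "L > 0"
  shows "\<exists>xs. graph_cycle E xs \<and> length xs \<le> L"
proof -
  define P where "P m \<longleftrightarrow> m > 0 \<and> (\<exists>i. i + m \<le> L \<and> w i = w (i + m))" for m
  define m where "m = (LEAST m. P m)"
  have "P L"
    using closed by (auto simp: P_def)
  then have "P m"
    unfolding m_def by (rule LeastI)
  then obtain i where i: "m > 0" "i + m \<le> L" "w i = w (i + m)"
    by (auto simp: P_def)
  have minimal: "\<not> P m'" if "m' < m" for m'
    using that not_less_Least unfolding m_def by blast
  have "m \<noteq> 1" "m \<noteq> 2"
    using i noloop[of i] nonback[of i] by auto
  then have "m \<ge> 3"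
    using i(1) by linarith
  have inj: "inj_on w {i..<i + m}"
  proof (rule linorder_inj_onI)
    fix x y assume xy: "x < y" "x \<in> {i..<i + m}" "y \<in> {i..<i + m}"
    show "w x \<noteq> w y"
    proof
      assume "w x = w y"
      then have "P (y - x)"
        using xy i by (auto simp: P_def intro!: exI[of _ x])
      moreover have "y - x < m"
        using xy by auto
      ultimately show False
        using minimal by blast
    qed
  qed auto
  have "graph_cycle E (map w [i..<i + m])"
    unfolding graph_cycle_def
  proof (intro conjI allI impI)
    fix j assume "j < length (map w [i..<i + m])"
    then have j: "j < m" by simp
    have nth: "map w [i..<i + m] ! l = w (i + l)" if "l < m" for l
      using that by simp
    show "{map w [i..<i + m] ! j, map w [i..<i + m] ! (Suc j mod length (map w [i..<i + m]))} \<in> E"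
    proof (cases "Suc j = m")
      case True
      then have "w (Suc (i + j)) = w i"
        using i(3) by (metis add_Suc_right)
      with True show ?thesis using edge[of "i + j"] nth[of 0] nth[of j] i j by simp
    next
      case False
      then show ?thesis using edge[of "i + j"] i j by simp
    qed
  qed (use \<open>m \<ge> 3\<close> inj in \<open>auto simp: distinct_map\<close>)
  then show ?thesis
    using i by force
qed

text \<open>The hypotheses say that \<open>a\<close> and \<open>b\<close> form a locally injective homomorphism from the
  bipartite graph \<open>I\<close> to \<open>E\<close>.\<close>

lemma closed_incidence_walk_constant:
  fixes a :: "'x \<Rightarrow> 'a" and b :: "'y \<Rightarrow> 'a"
  assumes hom: "\<And>x y. I x y \<Longrightarrow> {a x, b y} \<in> E"
    and inj_a: "\<And>x x' y. I x y \<Longrightarrow> I x' y \<Longrightarrow> a x = a x' \<Longrightarrow> x = x'"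
    and inj_b: "\<And>x y y'. I x y \<Longrightarrow> I x y' \<Longrightarrow> b y = b y' \<Longrightarrow> y = y'"
    and walk: "\<And>i. i < m \<Longrightarrow> I (v i) (y i)" "\<And>i. i < m \<Longrightarrow> I (v i) (y (Suc i))"
    and distinct: "inj_on v {..<m}"
    and closed: "y m = y 0"
    and E: "\<And>e. e \<in> E \<Longrightarrow> card e = 2"
    and girth: "girth E > enat (2 * m)"
  shows "\<forall>i\<le>m. y i = y 0"
proof -
  \<comment> \<open>Invariant: a reduced walk in \<open>E\<close> from \<open>b (y 0)\<close> to
    \<open>b (y m)\<close>. Its last clause names the point just before the end, which is what shows
    that the next extension does not backtrack; the clause for \<open>L = 0\<close> records that no
    step has changed the cell yet.\<close>
  define P where "P m \<longleftrightarrow> (\<exists>w L. L \<le> 2 * m \<and> w 0 = b (y 0) \<and> w L = b (y m) \<and>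
      (\<forall>i<L. {w i, w (Suc i)} \<in> E) \<and>
      (\<forall>i. Suc (Suc i) \<le> L \<longrightarrow> w i \<noteq> w (Suc (Suc i))) \<and>
      (L = 0 \<longrightarrow> (\<forall>i\<le>m. y i = y 0)) \<and>
      (L > 0 \<longrightarrow> (\<exists>j<m. w (L - 1) = a (v j) \<and> I (v j) (y m))))" for m
  have "P m"
    using walk distinct
  proof (induction m)
    case 0
    show ?case
      unfolding P_def by (rule exI[of _ "\<lambda>_. b (y 0)"], rule exI[of _ 0]) simp
  next
    case (Suc m)
    from Suc.prems have "inj_on v {..<m}"
      by (auto intro: inj_on_subset)
    then have "P m"
      using Suc.IH Suc.prems(1,2) less_SucI by blast
    then obtain w L where
      IH: "L \<le> 2 * m" "w 0 = b (y 0)" "w L = b (y m)"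
        "\<And>i. i < L \<Longrightarrow> {w i, w (Suc i)} \<in> E"
        "\<And>i. Suc (Suc i) \<le> L \<Longrightarrow> w i \<noteq> w (Suc (Suc i))"
        "L = 0 \<Longrightarrow> \<forall>i\<le>m. y i = y 0"
        "L > 0 \<Longrightarrow> \<exists>j<m. w (L - 1) = a (v j) \<and> I (v j) (y m)"
      unfolding P_def by blast
    have inc: "I (v m) (y m)" "I (v m) (y (Suc m))"
      using Suc.prems by auto
    show ?case
    proof (cases "y (Suc m) = y m")
      case True
      have "L = 0 \<longrightarrow> (\<forall>i\<le>Suc m. y i = y 0)"
        using IH(6) True by (metis le_Suc_eq order_refl)
      moreover have "L > 0 \<longrightarrow> (\<exists>j<Suc m. w (L - 1) = a (v j) \<and> I (v j) (y (Suc m)))"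
        using IH(7) True less_SucI by metis
      moreover have "L \<le> 2 * Suc m" "w L = b (y (Suc m))"
        using IH(1,3) True by auto
      ultimately show ?thesis
        unfolding P_def using IH(2,4,5) by blast
    next
      case False
      \<comment> \<open>Stationary steps are dropped; a step to a new cell appends two edges. There
        is no reversal at \<open>b (y m)\<close>, since the previous point \<open>v j\<close>
        differs from \<open>v m\<close> and \<open>a\<close> separates points on a common cell, and
        none at \<open>a (v m)\<close>, since \<open>b\<close> separates cells on a common
        point.\<close>
      define w' where "w' = w(Suc L := a (v m), Suc (Suc L) := b (y (Suc m)))"
      have "{w' i, w' (Suc i)} \<in> E" if lt: "i < Suc (Suc L)" for i
      proof -
        consider "i < L" | "i = L" | "i = Suc L"
          using lt by (auto simp: less_Suc_eq)
        then show ?thesis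
          using IH(3,4) hom[OF inc(1)] hom[OF inc(2)]
          by cases (auto simp: w'_def insert_commute)
      qed
      moreover have "w' i \<noteq> w' (Suc (Suc i))" if le: "Suc (Suc i) \<le> Suc (Suc L)" for i
      proof -
        have "Suc (Suc i) \<le> L \<or> L = Suc i \<or> i = L"
          using le by linarith
        then consider "Suc (Suc i) \<le> L" | "L = Suc i" | "i = L"
          by blast
        then show ?thesis
        proof cases
          case 2
          then obtain j where j: "j < m" "w i = a (v j)" "I (v j) (y m)"
            using IH(7) by auto
          then have "v j \<noteq> v m"
            using Suc.prems(3) by (auto simp: inj_on_def)
          then show ?thesis
            using 2 j inj_a[OF j(3) inc(1)] by (auto simp: w'_def)
        next
          case 3
          then show ?thesis
            using inj_b[OF inc] IH(3) False by (auto simp: w'_def)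
        qed (use IH(5) in \<open>auto simp: w'_def\<close>)
      qed
      moreover have "w' 0 = b (y 0)" "w' (Suc (Suc L)) = b (y (Suc m))" "w' (Suc L) = a (v m)"
        using IH(2) by (auto simp: w'_def)
      moreover have "Suc (Suc L) \<le> 2 * Suc m"
        using IH(1) by simp
      moreover have "\<exists>j<Suc m. w' (Suc (Suc L) - 1) = a (v j) \<and> I (v j) (y (Suc m))"
        using inc(2) \<open>w' (Suc L) = a (v m)\<close> by auto
      ultimately show ?thesis
        unfolding P_def by blast
    qed
  qed
  then obtain w L where wL: "L \<le> 2 * m" "w 0 = b (y 0)" "w L = b (y m)"
    "\<And>i. i < L \<Longrightarrow> {w i, w (Suc i)} \<in> E"
    "\<And>i. Suc (Suc i) \<le> L \<Longrightarrow> w i \<noteq> w (Suc (Suc i))"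
    "L = 0 \<Longrightarrow> \<forall>i\<le>m. y i = y 0"
    unfolding P_def by blast
  have "L = 0"
  proof (rule ccontr)
    assume "L \<noteq> 0"
    have "w i \<noteq> w (Suc i)" if "i < L" for i
      using E[OF wL(4)[OF that]] by auto
    with \<open>L \<noteq> 0\<close> wL closed obtain xs where "graph_cycle E xs" "length xs \<le> L"
      using nonbacktracking_closed_walk_cycle[of L w E] by auto
    then have "girth E \<le> enat (2 * m)"
      using girth_le[of E xs] wL(1) by (meson enat_ord_simps(1) order_trans)
    with girth show False by simp
  qed
  with wL(6) show ?thesis by blast
qed

section \<open>Splitting vertices into copies of bounded degree\<close>

text \<open>Each fibre of \<open>f\<close> on \<open>A\<close> is enumerated and cut into
  consecutive blocks of length \<open>d\<close>; a label encodes the value of \<open>f\<close>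
  together with the block number. Only the last block of a fibre can be incomplete. If
  \<open>f\<close> sends an arc to one of its ends, then \<open>g\<close> sends it to one of the
  copies of that end.\<close>

lemma block_labelling:
  fixes f :: "'p \<Rightarrow> 'v :: countable"
  assumes A: "finite A" and d: "d > 0"
  obtains g :: "'p \<Rightarrow> nat" and h :: "nat \<Rightarrow> 'v" where
    "\<And>p. h (g p) = f p"
    "\<And>j. card {p \<in> A. g p = j} \<le> d"
    "\<And>p q. p \<in> A \<Longrightarrow> q \<in> A \<Longrightarrow> f p = f q \<Longrightarrow> card {x \<in> A. g x = g p} \<noteq> d \<Longrightarrow>
       card {x \<in> A. g x = g q} \<noteq> d \<Longrightarrow> g p = g q"
proof -
  define B where "B v = {p \<in> A. f p = v}" for v
  have "finite (B v)" for v
    using A by (simp add: B_def)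
  then have "\<exists>u. bij_betw u (B v) {0..<card (B v)}" for v
    by (rule ex_bij_betw_finite_nat)
  then obtain u where u: "\<And>v. bij_betw (u v) (B v) {0..<card (B v)}"
    by metis
  define g where "g p = to_nat (f p, u (f p) p div d)" for p
  define h where "h j = fst (from_nat j :: 'v \<times> nat)" for j
  have fibre: "card {p \<in> A. g p = to_nat (v, j)} = card {i. i < card (B v) \<and> i div d = j}" for v j
  proof -
    have "{p \<in> A. g p = to_nat (v, j)} = {p \<in> B v. u v p div d = j}"
      by (auto simp: g_def B_def)
    moreover have "u v ` {p \<in> B v. u v p div d = j} = {i. i < card (B v) \<and> i div d = j}"
    proof -
      have "u v ` B v = {0..<card (B v)}"
        using u by (simp add: bij_betw_def)
      then show ?thesis
        by (auto simp: set_eq_iff image_iff) metis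
    qed
    moreover have "inj_on (u v) {p \<in> B v. u v p div d = j}"
      using u[of v] by (auto simp: bij_betw_def intro: inj_on_subset)
    ultimately show ?thesis
      using card_image[of "u v" "{p \<in> B v. u v p div d = j}"] by simp
  qed
  have interval: "{i. i div d = j} = {j * d..<Suc j * d}" for j
  proof -
    have "x = j \<longleftrightarrow> j \<le> x \<and> x < Suc j" for x :: nat
      by linarith
    then have "i div d = j \<longleftrightarrow> j * d \<le> i \<and> i < Suc j * d" for i
      using less_eq_div_iff_mult_less_eq[OF d, of j i] div_less_iff_less_mult[OF d, of i "Suc j"]
      by blast
    then show ?thesis
      by (simp only: set_eq_iff mem_Collect_eq atLeastLessThan_iff) blast
  qed
  have le: "card {i. i < M \<and> i div d = j} \<le> d" for M j
  proof -
    have "card {i. i < M \<and> i div d = j} \<le> card {j * d..<Suc j * d}"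
      unfolding interval[symmetric] using interval[of j] by (intro card_mono) auto
    then show ?thesis by simp
  qed
  \<comment> \<open>A block with a smaller number than \<open>M div d\<close> fits entirely below
    \<open>M\<close>, so it has \<open>d\<close> elements.\<close>
  have partial: "j = M div d" if "i < M" "i div d = j" "card {i. i < M \<and> i div d = j} \<noteq> d" for i j M
  proof (rule ccontr)
    assume "j \<noteq> M div d"
    moreover have "j \<le> M div d"
      using that by (auto intro: div_le_mono)
    ultimately have "Suc j \<le> M div d" by simp
    then have "Suc j * d \<le> M"
      by (metis div_times_less_eq_dividend mult_le_mono1 order_trans)
    then have "{i. i < M \<and> i div d = j} = {j * d..<Suc j * d}"
      unfolding interval[symmetric] using interval[of j] by auto
    with that show False by simp
  qed
  show thesis
  proof (rule that[of h g])
    show "h (g p) = f p" for p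
      by (simp add: h_def g_def)
    show "card {p \<in> A. g p = j} \<le> d" for j
    proof (cases "{p \<in> A. g p = j} = {}")
      case False
      then obtain p where "j = g p" by blast
      then have "j = to_nat (f p, u (f p) p div d)" by (simp add: g_def)
      then show ?thesis using fibre[of "f p" "u (f p) p div d"] le by simp
    next
      case True
      then show ?thesis by (metis card.empty zero_le)
    qed
    show "g p = g q"
      if "p \<in> A" "q \<in> A" "f p = f q" "card {x \<in> A. g x = g p} \<noteq> d" "card {x \<in> A. g x = g q} \<noteq> d" for p q
    proof -
      have last: "u (f z) z div d = card (B (f z)) div d" if "z \<in> A" "card {x \<in> A. g x = g z} \<noteq> d" for z
      proof (rule partial)
        show "u (f z) z < card (B (f z))"
          using u[of "f z"] that by (auto simp: bij_betw_def B_def)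
        show "card {i. i < card (B (f z)) \<and> i div d = u (f z) z div d} \<noteq> d"
          using that fibre[of "f z" "u (f z) z div d"] by (simp add: g_def)
      qed (rule refl)
      from last[OF \<open>p \<in> A\<close> that(4)] last[OF \<open>q \<in> A\<close> that(5)] show ?thesis
        using that(3) by (simp add: g_def)
    qed
  qed
qed

text \<open>\<open>F\<close> consists of the labels of full blocks. Each fibre has at most one
  incomplete block, so \<open>h\<close> is injective on the remaining labels and there are at most
  \<open>card V\<close> of them. The upper bound on \<open>card A\<close> supplies many vertices of
  degree exactly \<open>d\<close>; the other two bounds limit the number of cells.\<close>

lemma block_labelling_count:
  fixes f :: "'p \<Rightarrow> 'v :: countable"
  assumes A: "finite A" and d: "d > 0" and V: "f ` A \<subseteq> V" "finite V"
  shows "\<exists>(g :: 'p \<Rightarrow> nat) (h :: nat \<Rightarrow> 'v) F. (\<forall>p. h (g p) = f p) \<and>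
    (\<forall>j. card {p \<in> A. g p = j} \<le> d) \<and>
    F \<subseteq> g ` A \<and> (\<forall>j\<in>F. card {p \<in> A. g p = j} = d) \<and>
    card (g ` A) \<le> card F + card V \<and>
    d * card F \<le> card A \<and> card A \<le> d * (card F + card V)"
proof -
  obtain g :: "'p \<Rightarrow> nat" and h where g: "\<And>p. h (g p) = f p"
    "\<And>j. card {p \<in> A. g p = j} \<le> d"
    "\<And>p q. p \<in> A \<Longrightarrow> q \<in> A \<Longrightarrow> f p = f q \<Longrightarrow> card {x \<in> A. g x = g p} \<noteq> d \<Longrightarrow>
       card {x \<in> A. g x = g q} \<noteq> d \<Longrightarrow> g p = g q"
    by (rule block_labelling[OF A d, of f]) blast
  define F where "F = {j \<in> g ` A. card {p \<in> A. g p = j} = d}"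
  have "inj_on h (g ` A - F)"
  proof (rule inj_onI)
    fix i j assume ij: "i \<in> g ` A - F" "j \<in> g ` A - F" "h i = h j"
    then obtain p q where "p \<in> A" "q \<in> A" "i = g p" "j = g q" by blast
    with ij show "i = j"
      using g(1)[of p] g(1)[of q] g(3)[of p q] by (simp add: F_def)
  qed
  moreover have "h ` (g ` A - F) \<subseteq> V"
    using V g(1) by auto
  ultimately have "card (g ` A - F) \<le> card V"
    using V(2) by (meson card_inj_on_le)
  moreover have F: "F \<subseteq> g ` A" "finite F"
    using A by (auto simp: F_def)
  ultimately have count: "card (g ` A) \<le> card F + card V"
    using card_Diff_subset[of F "g ` A"] by simp
  have sum: "card A = (\<Sum>j\<in>g ` A. card {p \<in> A. g p = j})"
    using sum.group[OF A, of "g ` A" g "\<lambda>_. 1 :: nat"] A by simp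
  have "d * card F = (\<Sum>j\<in>F. card {p \<in> A. g p = j})"
    by (simp add: F_def)
  also have "\<dots> \<le> card A"
    unfolding sum using A F by (intro sum_mono2) auto
  finally have "d * card F \<le> card A" .
  moreover have "card A \<le> (\<Sum>j\<in>g ` A. d)"
    unfolding sum using g by (intro sum_mono) auto
  then have "card A \<le> d * card (g ` A)" by (simp add: mult.commute)
  then have "card A \<le> d * (card F + card V)"
    using count by (meson mult_le_mono2 order_trans)
  moreover have "\<forall>j\<in>F. card {p \<in> A. g p = j} = d"
    by (simp add: F_def)
  ultimately show ?thesis
    using g(1,2) F(1) count by blast
qed

section \<open>Independent random centres, by counting\<close>

text \<open>Union bound for independent uniform choices: each product is the probability that
  \<open>c y\<close> falls into \<open>bad S y\<close> for all \<open>y\<close>. Probabilities are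
  expressed as ratios of sizes of finite product sets.\<close>

lemma exists_choice_avoiding:
  fixes \<S> :: "'s set" and N :: "'i \<Rightarrow> 'a set" and bad :: "'s \<Rightarrow> 'i \<Rightarrow> 'a set"
  assumes fin: "finite \<S>" "finite \<Gamma>" "\<And>y. y \<in> \<Gamma> \<Longrightarrow> finite (N y)"
    and nonempty: "\<And>y. y \<in> \<Gamma> \<Longrightarrow> N y \<noteq> {}"
    and bad: "\<And>S y. S \<in> \<S> \<Longrightarrow> y \<in> \<Gamma> \<Longrightarrow> bad S y \<subseteq> N y"
    and small: "(\<Sum>S\<in>\<S>. \<Prod>y\<in>\<Gamma>. real (card (bad S y)) / real (card (N y))) < 1"
  shows "\<exists>c. (\<forall>y\<in>\<Gamma>. c y \<in> N y) \<and> (\<forall>S\<in>\<S>. \<exists>y\<in>\<Gamma>. c y \<notin> bad S y)"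
proof -
  define T where "T = (\<Prod>y\<in>\<Gamma>. card (N y))"
  have cardT: "card (PiE \<Gamma> N) = T"
    using fin by (simp add: card_PiE T_def)
  have "T > 0"
    unfolding T_def using fin nonempty by (auto intro!: prod_pos simp: card_gt_0_iff)
  have "card (\<Union>S\<in>\<S>. PiE \<Gamma> (bad S)) \<le> (\<Sum>S\<in>\<S>. card (PiE \<Gamma> (bad S)))"
    using fin(1) by (rule card_UN_le)
  also have "\<dots> = (\<Sum>S\<in>\<S>. \<Prod>y\<in>\<Gamma>. card (bad S y))"
    using fin by (simp add: card_PiE)
  finally have "real (card (\<Union>S\<in>\<S>. PiE \<Gamma> (bad S))) \<le> real (\<Sum>S\<in>\<S>. \<Prod>y\<in>\<Gamma>. card (bad S y))"
    by (rule of_nat_mono)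
  also have "\<dots> = (\<Sum>S\<in>\<S>. \<Prod>y\<in>\<Gamma>. real (card (bad S y)) / real (card (N y))) * T"
  proof -
    have "(\<Prod>y\<in>\<Gamma>. real (card (N y))) = real T"
      by (simp add: T_def)
    with \<open>T > 0\<close> show ?thesis
      by (simp add: prod_dividef flip: sum_divide_distrib)
  qed
  also have "\<dots> < 1 * real T"
    using small \<open>T > 0\<close> by (intro mult_strict_right_mono) auto
  finally have "card (\<Union>S\<in>\<S>. PiE \<Gamma> (bad S)) < card (PiE \<Gamma> N)"
    by (simp add: cardT)
  moreover have "finite (\<Union>S\<in>\<S>. PiE \<Gamma> (bad S))"
    using fin finite_subset[OF bad] by (intro finite_UN_I finite_PiE) blast+
  ultimately obtain c where c: "c \<in> PiE \<Gamma> N" "c \<notin> (\<Union>S\<in>\<S>. PiE \<Gamma> (bad S))"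
    by (meson card_mono not_less subsetI)
  have "\<exists>y\<in>\<Gamma>. c y \<notin> bad S y" if "S \<in> \<S>" for S
  proof (rule ccontr)
    assume "\<not> ?thesis"
    with c(1) have "c \<in> PiE \<Gamma> (bad S)"
      unfolding PiE_iff by blast
    with c(2) that show False by blast
  qed
  moreover have "\<forall>y\<in>\<Gamma>. c y \<in> N y"
    using c(1) by (simp add: PiE_iff)
  ultimately show ?thesis
    by blast
qed

text \<open>The subsets meeting a cell in fewer than \<open>r\<close> points cannot be hit there; the term
  \<open>r * card \<Gamma>\<close> accounts for this loss.\<close>

lemma exists_hitting_centres:
  fixes X :: "'a set" and N :: "'i \<Rightarrow> 'a set"
  assumes fin: "finite X" "finite \<Gamma>" and N: "\<And>y. y \<in> \<Gamma> \<Longrightarrow> N y \<subseteq> X"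
    and nonempty: "\<And>y. y \<in> \<Gamma> \<Longrightarrow> N y \<noteq> {}"
    and size: "\<And>y. y \<in> \<Gamma> \<Longrightarrow> card (N y) \<le> s" and "s > 0"
    and deg: "\<And>x. x \<in> X \<Longrightarrow> d \<le> card {y \<in> \<Gamma>. x \<in> N y}"
    and n: "card X \<le> n" "n > 0"
    and num: "real t * ln (real n) * real s < real t * real d - real r * real (card \<Gamma>)"
  shows "\<exists>c. (\<forall>y\<in>\<Gamma>. c y \<in> N y) \<and>
    (\<forall>S. S \<subseteq> X \<and> card S = t \<longrightarrow> (\<exists>y\<in>\<Gamma>. c y \<in> S \<and> r \<le> card (S \<inter> N y)))"
proof -
  define \<S> where "\<S> = {S. S \<subseteq> X \<and> card S = t}"
  \<comment> \<open>The centres for which the cell of \<open>y\<close> yields no edge inside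
    \<open>S\<close>. If the cell meets \<open>S\<close> in fewer than \<open>r\<close> points,
    every centre is bad.\<close>
  define bad where "bad S y = (if r \<le> card (S \<inter> N y) then N y - S else N y)" for S y
  have finN: "finite (N y)" if "y \<in> \<Gamma>" for y
    using N[OF that] fin(1) finite_subset by blast
  \<comment> \<open>Subtracting \<open>r\<close> in the exponent gives one bound for both cases:
    with fewer than \<open>r\<close> common points the ratio is 1 and the exponent is positive;
    otherwise \<open>1 - x \<le> exp (- x)\<close> applies.\<close>
  have ratio: "real (card (bad S y)) / real (card (N y)) \<le> exp (- (real (card (S \<inter> N y)) - real r) / real s)"
    if "y \<in> \<Gamma>" for S y
  proof -
    define m l where "m = card (N y)" and "l = card (S \<inter> N y)"
    have "m > 0" "m \<le> s"
      using finN nonempty size that by (auto simp: m_def card_gt_0_iff)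
    show ?thesis
    proof (cases "r \<le> l")
      case True
      have "l \<le> m"
        unfolding l_def m_def using finN[OF that] by (intro card_mono) auto
      have "card (bad S y) = m - l"
        using True finN[OF that] by (simp add: bad_def l_def m_def card_Diff_subset_Int Int_commute)
      then have "real (card (bad S y)) / real m = 1 - real l / real m"
        using \<open>l \<le> m\<close> \<open>m > 0\<close> by (simp add: of_nat_diff diff_divide_distrib)
      also have "\<dots> \<le> exp (- (real l / real m))"
        using exp_ge_add_one_self[of "- (real l / real m)"] by simp
      also have "\<dots> \<le> exp (- ((real l - real r) / real s))"
        using \<open>m > 0\<close> \<open>m \<le> s\<close> True by (auto intro!: frac_le)
      finally show ?thesis
        by (simp add: l_def m_def minus_divide_left)
    next
      case False
      then have "0 \<le> - (real l - real r) / real s"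
        by (intro divide_nonneg_nonneg) auto
      then have "1 \<le> exp (- (real l - real r) / real s)"
        by simp
      moreover have "real (card (bad S y)) / real (card (N y)) = 1"
        using False \<open>m > 0\<close> by (simp add: bad_def l_def m_def)
      ultimately show ?thesis
        by (simp add: l_def)
    qed
  qed
  have product: "(\<Prod>y\<in>\<Gamma>. real (card (bad S y)) / real (card (N y)))
      \<le> exp (- (real t * real d - real r * real (card \<Gamma>)) / real s)" if "S \<in> \<S>" for S
  proof -
    have S: "S \<subseteq> X" "card S = t" "finite S"
      using that fin(1) finite_subset by (auto simp: \<S>_def)
    \<comment> \<open>Double counting of the incidences between \<open>S\<close> and the
      cells.\<close>
    have "t * d = (\<Sum>x\<in>S. d)"
      using S by simp
    also have "\<dots> \<le> (\<Sum>x\<in>S. card {y \<in> \<Gamma>. x \<in> N y})"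
      using S deg by (intro sum_mono) auto
    also have "\<dots> = (\<Sum>y\<in>\<Gamma>. card {x \<in> S. x \<in> N y})"
      using sum_multicount_gen[OF S(3) fin(2), of "\<lambda>x y. x \<in> N y" "\<lambda>y. card {x \<in> S. x \<in> N y}"] by simp
    also have "\<dots> = (\<Sum>y\<in>\<Gamma>. card (S \<inter> N y))"
      by (simp add: Int_def)
    finally have degsum: "real t * real d \<le> (\<Sum>y\<in>\<Gamma>. real (card (S \<inter> N y)))"
      by (metis of_nat_mono of_nat_mult of_nat_sum)
    have "(\<Prod>y\<in>\<Gamma>. real (card (bad S y)) / real (card (N y)))
        \<le> (\<Prod>y\<in>\<Gamma>. exp (- (real (card (S \<inter> N y)) - real r) / real s))"
      using ratio by (intro prod_mono) auto
    also have "\<dots> = exp (\<Sum>y\<in>\<Gamma>. - (real (card (S \<inter> N y)) - real r) / real s)"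
      using fin(2) by (simp add: exp_sum)
    also have "(\<Sum>y\<in>\<Gamma>. - (real (card (S \<inter> N y)) - real r) / real s)
        = - ((\<Sum>y\<in>\<Gamma>. real (card (S \<inter> N y))) - real r * real (card \<Gamma>)) / real s"
      by (simp add: sum_divide_distrib[symmetric] sum_subtractf)
    also have "exp \<dots> \<le> exp (- (real t * real d - real r * real (card \<Gamma>)) / real s)"
      using degsum \<open>s > 0\<close> by (simp add: divide_right_mono)
    finally show ?thesis .
  qed
  have "card \<S> \<le> n ^ t"
  proof -
    have "card \<S> = card X choose t"
      unfolding \<S>_def using fin(1) by (rule n_subsets)
    also have "\<dots> \<le> card X ^ t"
      by (cases "t \<le> card X") (auto simp: binomial_le_pow binomial_eq_0)
    also have "\<dots> \<le> n ^ t"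
      using n by (intro power_mono) auto
    finally show ?thesis .
  qed
  then have "real (card \<S>) \<le> exp (real t * ln (real n))"
    using n(2) by (simp add: exp_of_nat_mult of_nat_mono flip: of_nat_power)
  have "(\<Sum>S\<in>\<S>. \<Prod>y\<in>\<Gamma>. real (card (bad S y)) / real (card (N y)))
      \<le> (\<Sum>S\<in>\<S>. exp (- (real t * real d - real r * real (card \<Gamma>)) / real s))"
    using product by (rule sum_mono)
  also have "\<dots> \<le> exp (real t * ln (real n)) * exp (- (real t * real d - real r * real (card \<Gamma>)) / real s)"
    using \<open>real (card \<S>) \<le> _\<close> by (simp add: mult_right_mono)
  also have "\<dots> < 1"
  proof -
    have "real t * ln (real n) < (real t * real d - real r * real (card \<Gamma>)) / real s"
      using num \<open>s > 0\<close> by (simp add: pos_less_divide_eq)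
    moreover have "- (real t * real d - real r * real (card \<Gamma>)) / real s =
        - ((real t * real d - real r * real (card \<Gamma>)) / real s)"
      by (rule minus_divide_left[symmetric])
    ultimately show ?thesis
      by (simp del: minus_diff_eq flip: exp_add)
  qed
  finally have small: "(\<Sum>S\<in>\<S>. \<Prod>y\<in>\<Gamma>. real (card (bad S y)) / real (card (N y))) < 1" .
  have "finite \<S>"
    using fin(1) by (simp add: \<S>_def)
  have "bad S y \<subseteq> N y" for S y
    by (auto simp: bad_def)
  have "\<exists>c. (\<forall>y\<in>\<Gamma>. c y \<in> N y) \<and> (\<forall>S\<in>\<S>. \<exists>y\<in>\<Gamma>. c y \<notin> bad S y)"
    using \<open>finite \<S>\<close> fin(2) finN nonempty \<open>\<And>S y. bad S y \<subseteq> N y\<close> small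
    by (rule exists_choice_avoiding)
  then obtain c where c: "\<And>y. y \<in> \<Gamma> \<Longrightarrow> c y \<in> N y" "\<And>S. S \<in> \<S> \<Longrightarrow> \<exists>y\<in>\<Gamma>. c y \<notin> bad S y"
    by blast
  have "\<exists>y\<in>\<Gamma>. c y \<in> S \<and> r \<le> card (S \<inter> N y)" if S: "S \<subseteq> X" "card S = t" for S
  proof -
    have "\<exists>y\<in>\<Gamma>. c y \<notin> bad S y"
      using S by (intro c(2)) (simp add: \<S>_def)
    then show ?thesis
      using c(1) by (fastforce simp: bad_def split: if_splits)
  qed
  with c(1) show ?thesis
    by blast
qed

section \<open>From a graph of large girth to the hypergraph\<close>

text \<open>Arcs are ordered pairs; splitting first ends gives the points and splitting second ends
  gives the cells. In \<open>num\<close>, the last bracket bounds the number of cells. Every size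
  \<open>N \<le> n\<close> is available because surplus points can be discarded without lowering the
  degrees of those that stay.\<close>

lemma hypergraph_of_graph:
  fixes V :: "'a :: countable set"
  assumes graph: "uniform_hypergraph 2 V E" "card V = n" "girth E > enat (2 * k)"
    and edges: "card E \<ge> 2 * n * d"
    and pos: "d > 0" "s > 0" "n > 0" "r > 0" "k > 0" and N: "N \<le> n"
    and num: "real t * ln (real n) * real s < real t * real d - real r * (2 * real n * real d / real s + real n)"
  shows "\<exists>(X :: nat set) H. uniform_hypergraph r X H \<and> card X = N \<and>
    \<not> contains_member H (nontrivial_berge_cycles r k) \<and>
    \<not> (\<exists>S. independent_set X H S \<and> card S = t)"
proof -
  define A\<^sub>0 where "A\<^sub>0 = {(a, b). {a, b} \<in> E}"
  have V: "finite V" and E: "\<And>e. e \<in> E \<Longrightarrow> e \<subseteq> V" "\<And>e. e \<in> E \<Longrightarrow> card e = 2"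
    using graph(1) by (auto simp: uniform_hypergraph_def)
  have "A\<^sub>0 \<subseteq> V \<times> V"
    using E(1) by (auto simp: A\<^sub>0_def)
  then have "finite A\<^sub>0"
    using V finite_subset by blast
  have "E \<subseteq> (\<lambda>(a, b). {a, b}) ` A\<^sub>0"
  proof
    fix e assume "e \<in> E"
    then obtain a b where "e = {a, b}"
      using E(2) by (meson card_2_iff)
    with \<open>e \<in> E\<close> show "e \<in> (\<lambda>(a, b). {a, b}) ` A\<^sub>0"
      by (auto simp: A\<^sub>0_def)
  qed
  with \<open>finite A\<^sub>0\<close> have "card E \<le> card A\<^sub>0"
    by (rule surj_card_le)
  with edges have "2 * n * d \<le> card A\<^sub>0" by simp
  then obtain A where A: "A \<subseteq> A\<^sub>0" "card A = 2 * n * d" "finite A"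
    by (rule obtain_subset_with_card_n)
  have "fst ` A \<subseteq> V" "snd ` A \<subseteq> V"
    using A(1) \<open>A\<^sub>0 \<subseteq> V \<times> V\<close> by auto
  obtain \<alpha> and \<beta> :: "'a \<times> 'a \<Rightarrow> nat" and F where \<beta>: "F \<subseteq> \<beta> ` A" "\<forall>p. \<alpha> (\<beta> p) = fst p"
    "\<forall>j\<in>F. card {p \<in> A. \<beta> p = j} = d" "card A \<le> d * (card F + card V)"
    using block_labelling_count[OF A(3) pos(1) \<open>fst ` A \<subseteq> V\<close> V]
    by (elim exE conjE) (rule that, assumption+)
  obtain \<delta> and \<gamma> :: "'a \<times> 'a \<Rightarrow> nat" and F' where \<gamma>: "F' \<subseteq> \<gamma> ` A" "\<forall>p. \<delta> (\<gamma> p) = snd p"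
    "\<forall>j. card {p \<in> A. \<gamma> p = j} \<le> s" "card (\<gamma> ` A) \<le> card F' + card V" "s * card F' \<le> card A"
    using block_labelling_count[OF A(3) pos(2) \<open>snd ` A \<subseteq> V\<close> V]
    by (elim exE conjE) (rule that, assumption+)
  \<comment> \<open>The factor 2 in the number of arcs pays for the at most \<open>n\<close>
    incomplete labels: at least \<open>n\<close> full ones remain.\<close>
  have "d * (2 * n) \<le> d * (card F + n)"
    using \<beta>(4) A(2) graph(2) by (simp add: mult.commute mult.left_commute)
  then have "n \<le> card F"
    using pos(1) by simp
  with N have "N \<le> card F" by simp
  then obtain X where X: "X \<subseteq> F" "card X = N" "finite X"
    by (rule obtain_subset_with_card_n)
  define I where "I x y \<longleftrightarrow> (\<exists>p\<in>A. \<beta> p = x \<and> \<gamma> p = y)" for x y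
  \<comment> \<open>Splitting creates no parallel arcs, since labels remember the original
    ends.\<close>
  have arc_eqI: "p = q" if "\<beta> p = \<beta> q" "\<gamma> p = \<gamma> q" for p q
    using that \<beta>(2) \<gamma>(2) by (metis prod_eqI)
  have hom: "{\<alpha> x, \<delta> y} \<in> E" if "I x y" for x y
    using that A(1) \<beta>(2) \<gamma>(2) by (auto simp: I_def A\<^sub>0_def)
  \<comment> \<open>Together with \<open>inj_\<delta>\<close>, this says that undoing the splitting
    is injective around every cell and every point, which is how the girth of \<open>E\<close>
    controls the split structure.\<close>
  have inj_\<alpha>: "x = x'" if "I x y" "I x' y" "\<alpha> x = \<alpha> x'" for x x' y
    using that \<beta>(2) \<gamma>(2) unfolding I_def by (metis prod_eqI)
  have inj_\<delta>: "y = y'" if "I x y" "I x y'" "\<delta> y = \<delta> y'" for x y y'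
    using that \<beta>(2) \<gamma>(2) unfolding I_def by (metis prod_eqI)
  define C where "C y = {x \<in> X. I x y}" for y
  \<comment> \<open>Restricting to \<open>X\<close> may empty a cell; such cells have no possible
    centre and are left out.\<close>
  define \<Gamma> where "\<Gamma> = {y \<in> \<gamma> ` A. C y \<noteq> {}}"
  have "\<exists>c. (\<forall>y\<in>\<Gamma>. c y \<in> C y) \<and>
    (\<forall>S. S \<subseteq> X \<and> card S = t \<longrightarrow> (\<exists>y\<in>\<Gamma>. c y \<in> S \<and> r \<le> card (S \<inter> C y)))"
  proof (rule exists_hitting_centres)
    show "finite \<Gamma>"
      using A(3) by (simp add: \<Gamma>_def)
    show "card (C y) \<le> s" for y
    proof -
      have "C y \<subseteq> \<beta> ` {p \<in> A. \<gamma> p = y}"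
        by (auto simp: C_def I_def)
      then have "card (C y) \<le> card {p \<in> A. \<gamma> p = y}"
        using A(3) by (intro surj_card_le) auto
      with \<gamma>(3) show ?thesis
        using order_trans by blast
    qed
    show "d \<le> card {y \<in> \<Gamma>. x \<in> C y}" if "x \<in> X" for x
    proof -
      have "\<gamma> ` {p \<in> A. \<beta> p = x} \<subseteq> {y \<in> \<Gamma>. x \<in> C y}"
        using that by (auto simp: \<Gamma>_def C_def I_def)
      moreover have "inj_on \<gamma> {p \<in> A. \<beta> p = x}"
        by (rule inj_onI) (rule arc_eqI, simp_all)
      ultimately have "card {p \<in> A. \<beta> p = x} \<le> card {y \<in> \<Gamma>. x \<in> C y}"
        using \<open>finite \<Gamma>\<close> by (intro card_inj_on_le) auto
      then show ?thesis
        using \<beta>(3) X(1) that by auto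
    qed
    show "real t * ln (real n) * real s < real t * real d - real r * real (card \<Gamma>)"
    proof -
      \<comment> \<open>At most \<open>2 * n * d / s\<close> cells are full before restriction to
        \<open>X\<close>, and at most \<open>n\<close> are incomplete.\<close>
      have "card \<Gamma> \<le> card (\<gamma> ` A)"
        using A(3) by (intro card_mono) (auto simp: \<Gamma>_def)
      also have "\<dots> \<le> card F' + n"
        using \<gamma>(4) graph(2) by simp
      finally have "real (card \<Gamma>) \<le> real (card F') + real n"
        by linarith
      moreover have "real s * real (card F') \<le> 2 * real n * real d"
        using \<gamma>(5) A(2) by (metis of_nat_le_iff of_nat_mult of_nat_numeral)
      then have "real (card F') \<le> 2 * real n * real d / real s"
        using pos(2) by (simp add: pos_le_divide_eq mult.commute)
      ultimately have "real r * real (card \<Gamma>) \<le> real r * (2 * real n * real d / real s + real n)"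
        by (intro mult_left_mono) auto
      with num show ?thesis by linarith
    qed
  qed (use X N pos in \<open>auto simp: C_def \<Gamma>_def\<close>)
  then obtain c where c: "\<And>y. y \<in> \<Gamma> \<Longrightarrow> c y \<in> C y"
    "\<And>S. S \<subseteq> X \<Longrightarrow> card S = t \<Longrightarrow> \<exists>y\<in>\<Gamma>. c y \<in> S \<and> r \<le> card (S \<inter> C y)"
    by blast
  define H where "H = {e. e \<subseteq> X \<and> card e = r \<and> (\<exists>y\<in>\<Gamma>. e \<subseteq> C y \<and> c y \<in> e)}"
  have "uniform_hypergraph r X H"
    using X(3) by (auto simp: uniform_hypergraph_def H_def)
  moreover have "\<not> independent_set X H S" if cardS: "card S = t" for S
  proof
    assume S: "independent_set X H S"
    then have "S \<subseteq> X" by (simp add: independent_set_def)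
    then obtain y where y: "y \<in> \<Gamma>" "c y \<in> S" "r \<le> card (S \<inter> C y)"
      using c(2)[OF _ cardS] by blast
    then have "{c y} \<subseteq> S \<inter> C y"
      using c(1) by auto
    moreover have "finite (S \<inter> C y)"
      using \<open>S \<subseteq> X\<close> X(3) finite_subset by blast
    moreover have "card {c y} \<le> r"
      using pos(4) by simp
    ultimately obtain e where e: "{c y} \<subseteq> e" "e \<subseteq> S \<inter> C y" "card e = r"
      using exists_subset_between[of "{c y}" r "S \<inter> C y"] y(3) by blast
    then have "e \<in> H"
      using y(1) \<open>S \<subseteq> X\<close> by (auto simp: H_def)
    with S e(2) show False
      by (auto simp: independent_set_def)
  qed
  moreover have "\<not> contains_member H (nontrivial_berge_cycles r k)"
  proof
    assume "contains_member H (nontrivial_berge_cycles r k)"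
    then obtain F f where F: "F \<in> nontrivial_berge_cycles r k" and f: "inj_on f (\<Union>F)"
      and fF: "\<And>e. e \<in> F \<Longrightarrow> f ` e \<in> H"
      unfolding contains_member_def by blast
    from F obtain e where e: "nontrivial_berge_cycle k e" "F = e ` {..<k}"
      unfolding nontrivial_berge_cycles_def by blast
    have fe: "f ` e i \<in> H" if "i < k" for i
      using fF e(2) that by blast
    from e(1) obtain u where u: "inj_on u {..<k}" "\<forall>i\<in>{..<k}. u i \<in> e i \<inter> e (Suc i mod k)"
      unfolding nontrivial_berge_cycle_def berge_cycle_def has_sdr_def by blast
    have u1: "u i \<in> e i" and u2: "u i \<in> e (Suc i mod k)" if "i < k" for i
      using u(2) that by auto
    have uF: "u i \<in> \<Union>F" if "i < k" for i
      using u1 e(2) that by blast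
    have "\<forall>i\<in>{..<k}. \<exists>y. f ` e i \<subseteq> C y \<and> c y \<in> f ` e i"
      using fe unfolding H_def by blast
    then have "\<exists>y. \<forall>i\<in>{..<k}. f ` e i \<subseteq> C (y i) \<and> c (y i) \<in> f ` e i"
      by (rule bchoice)
    then obtain y where y_all: "\<forall>i\<in>{..<k}. f ` e i \<subseteq> C (y i) \<and> c (y i) \<in> f ` e i"
      by (rule exE)
    have y: "f ` e i \<subseteq> C (y i)" "c (y i) \<in> f ` e i" if "i < k" for i
      using y_all[THEN bspec, of i] that by (simp_all only: lessThan_iff)
    \<comment> \<open>The images of the distinct representatives and the cells of the edges
      alternate in a closed walk; indices modulo \<open>k\<close> make it close up. Girth above
      \<open>2 * k\<close> forces a single cell.\<close>
    have "\<forall>i\<le>k. y (i mod k) = y (0 mod k)"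
    proof (rule closed_incidence_walk_constant[of I \<alpha> \<delta> E k "\<lambda>i. f (u i)" "\<lambda>i. y (i mod k)"])
      show "inj_on (\<lambda>i. f (u i)) {..<k}"
      proof (rule inj_onI)
        fix i j assume ij: "i \<in> {..<k}" "j \<in> {..<k}" "f (u i) = f (u j)"
        then have "u i = u j"
          using inj_onD[OF f] uF by blast
        with ij u(1) show "i = j"
          by (auto dest: inj_onD)
      qed
      show "I (f (u i)) (y (i mod k))" if "i < k" for i
        using y(1)[OF that] u1[OF that] that by (auto simp: C_def)
      show "I (f (u i)) (y (Suc i mod k))" if "i < k" for i
        using y(1)[of "Suc i mod k"] u2[OF that] pos(5) by (auto simp: C_def)
    qed (use hom inj_\<alpha> inj_\<delta> E(2) graph(3) in auto)
    then have const: "y i = y 0" if "i < k" for i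
      using that by (metis less_imp_le mod_less pos(5))
    \<comment> \<open>All edges now contain the centre of the same cell. Its preimage, unique by
      injectivity of \<open>f\<close>, lies in every \<open>e i\<close>, so the Berge cycle is
      trivial.\<close>
    obtain w where w: "w \<in> e 0" "f w = c (y 0)"
      using y(2)[OF pos(5)] by auto
    have "w \<in> e i" if "i < k" for i
    proof -
      have "c (y 0) \<in> f ` e i"
        using y(2)[OF that] const[OF that] by simp
      then obtain w' where "w' \<in> e i" "f w' = c (y 0)"
        by auto
      moreover have "w' \<in> \<Union>F" "w \<in> \<Union>F"
        using \<open>w' \<in> e i\<close> w(1) that pos(5) e(2) by blast+
      ultimately show ?thesis
        using inj_onD[OF f, of w' w] w(2) by simp
    qed
    then have "w \<in> (\<Inter>i<k. e i)" by simp
    with e(1) show False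
      by (simp add: nontrivial_berge_cycle_def)
  qed
  ultimately show ?thesis
    using X(2) by blast
qed

section \<open>Choice of parameters and asymptotic estimates\<close>

text \<open>The logarithm is bounded with exponent \<open>a / 2\<close>; the other half of the power
  absorbs the constant \<open>2 / (a * \<epsilon>)\<close> from the threshold \<open>M\<close>
  on.\<close>

lemma eventually_ln_le_powr:
  fixes a \<epsilon> :: real
  assumes "a > 0" "\<epsilon> > 0"
  shows "\<forall>\<^sub>F n :: nat in sequentially. ln (real n) \<le> \<epsilon> * real n powr a"
proof -
  define M where "M = nat \<lceil>(2 / (a * \<epsilon>)) powr (2 / a)\<rceil>"
  have "ln (real n) \<le> \<epsilon> * real n powr a" if n: "n \<ge> max 1 M" for n
  proof -
    have "ln (real n) \<le> real n powr (a / 2) / (a / 2)"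
      using assms n by (intro ln_powr_bound) auto
    also have "\<dots> = (2 / a) * real n powr (a / 2)"
      by simp
    also have "\<dots> \<le> (\<epsilon> * real n powr (a / 2)) * real n powr (a / 2)"
    proof (rule mult_right_mono)
      have "(2 / (a * \<epsilon>)) powr (2 / a) \<le> real n"
        using n unfolding M_def by linarith
      then have "((2 / (a * \<epsilon>)) powr (2 / a)) powr (a / 2) \<le> real n powr (a / 2)"
        using assms by (intro powr_mono2) auto
      then have "2 / (a * \<epsilon>) \<le> real n powr (a / 2)"
        using assms by (simp add: powr_powr)
      then show "2 / a \<le> \<epsilon> * real n powr (a / 2)"
        using assms by (simp add: field_simps)
    qed simp
    also have "\<dots> = \<epsilon> * real n powr a"
      by (simp flip: powr_add)
    finally show ?thesis .
  qed
  then show ?thesis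
    by (rule eventually_sequentiallyI)
qed

text \<open>\<open>d\<close> is as large as the number of edges permits. Taking \<open>s\<close>
  about \<open>d / (3 * ln n)\<close> uses up only a third of \<open>t * d\<close> on the
  \<open>n ^ t\<close> candidate sets and keeps \<open>d / s\<close> of order \<open>ln n\<close>.
  The constant 12 in \<open>large\<close> ensures \<open>d \<ge> 3 * ln n\<close>, hence
  \<open>s > 0\<close>.\<close>

lemma parameter_choice:
  fixes c :: real
  assumes c: "c > 0" and k: "k > 0" and n: "n \<ge> 3"
    and large: "12 * ln (real n) \<le> c * real n powr (1 / real k)"
    and t: "(1 + 80 * real r / c) * real n powr (1 - 1 / real k) * ln (real n) \<le> real t"
  obtains d s where "d > (0 :: nat)" "s > (0 :: nat)"
    "2 * real n * real d \<le> c * real n powr (1 + 1 / real k)"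
    "real t * ln (real n) * real s < real t * real d - real r * (2 * real n * real d / real s + real n)"
proof -
  define P L where "P = real n powr (1 / real k)" and "L = ln (real n)"
  define d where "d = nat \<lfloor>c * P / 2\<rfloor>"
  define s where "s = nat \<lfloor>real d / (3 * L)\<rfloor>"
  have "exp 1 \<le> real n"
    using exp_le n by linarith
  then have "L \<ge> 1"
    unfolding L_def using n by (simp add: ln_ge_iff)
  have cP: "12 * L \<le> c * P"
    using large by (simp add: P_def L_def)
  have d: "real d \<le> c * P / 2" "c * P / 4 \<le> real d"
    using cP \<open>L \<ge> 1\<close> unfolding d_def by linarith+
  then have "3 * L \<le> real d"
    using cP by linarith
  then have "1 \<le> real d / (3 * L)"
    using \<open>L \<ge> 1\<close> by (simp add: pos_le_divide_eq)
  then have s: "real s \<le> real d / (3 * L)" "real d / (6 * L) \<le> real s" "s > 0"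
  proof -
    define q where "q = real d / (3 * L)"
    have "real d / (6 * L) = q / 2"
      by (simp add: q_def)
    moreover have "1 \<le> q"
      using \<open>1 \<le> real d / (3 * L)\<close> by (simp add: q_def)
    moreover from this have "1 \<le> \<lfloor>q\<rfloor>"
      by simp
    then have "real s \<le> q" "q / 2 \<le> real s" "s > 0"
      using \<open>1 \<le> q\<close> unfolding s_def q_def[symmetric] by linarith+
    ultimately show "real s \<le> real d / (3 * L)" "real d / (6 * L) \<le> real s" "s > 0"
      by (simp_all add: q_def)
  qed
  show thesis
  proof (rule that[of d s])
    show "d > 0"
      using \<open>3 * L \<le> real d\<close> \<open>L \<ge> 1\<close> by linarith
    show "s > 0" by fact
    have "2 * real n * real d \<le> 2 * real n * (c * P / 2)"
      using d(1) by (intro mult_left_mono) auto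
    also have "\<dots> = c * real n powr (1 + 1 / real k)"
      using n by (simp add: P_def powr_add)
    finally show "2 * real n * real d \<le> c * real n powr (1 + 1 / real k)" .
    have ts: "real t * L * real s \<le> real t * real d / 3"
    proof -
      have "L * real s \<le> real d / 3"
        using s(1) \<open>L \<ge> 1\<close> by (simp add: field_simps)
      then have "real t * (L * real s) \<le> real t * (real d / 3)"
        by (rule mult_left_mono) simp
      then show ?thesis by (simp add: mult.assoc)
    qed
    have "real d / real s \<le> 6 * L"
      using s(2,3) \<open>L \<ge> 1\<close> by (simp add: field_simps)
    \<comment> \<open>The constant 13 is 12 from the full cells plus 1 from the incomplete ones,
      where \<open>1 \<le> L\<close> is used.\<close>
    then have "2 * real n * (real d / real s) + real n \<le> 2 * real n * (6 * L) + real n * L"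
      using \<open>L \<ge> 1\<close> n by (intro add_mono mult_left_mono) (auto simp: mult_le_cancel_left1)
    then have "real r * (2 * real n * real d / real s + real n) \<le> real r * (13 * (real n * L))"
      by (intro mult_left_mono) (auto simp: algebra_simps)
    then have loss: "real r * (2 * real n * real d / real s + real n) \<le> 13 * real r * (real n * L)"
      by simp
    have "(1 + 80 * real r / c) * (real n powr (1 - 1 / real k) * L) * (c * P / 4) \<le> real t * real d"
      using t d(2) c \<open>L \<ge> 1\<close> by (intro mult_mono) (auto simp: L_def P_def mult.assoc)
    moreover have "(1 + 80 * real r / c) * (real n powr (1 - 1 / real k) * L) * (c * P / 4)
        = (c + 80 * real r) / 4 * (real n * L)"
    proof -
      have "real n powr (1 - 1 / real k) * P = real n"
        using n by (simp add: P_def flip: powr_add)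
      then have "(c + 80 * real r) / 4 * (real n * L)
          = (c + 80 * real r) / 4 * (real n powr (1 - 1 / real k) * P * L)"
        by simp
      also have "\<dots> = (1 + 80 * real r / c) * (real n powr (1 - 1 / real k) * L) * (c * P / 4)"
        using c by (simp add: field_simps)
      finally show ?thesis by (rule sym)
    qed
    ultimately have "(c + 80 * real r) / 4 * (real n * L) \<le> real t * real d"
      by (simp only:)
    \<comment> \<open>This is where 80 comes from: two thirds of \<open>80 / 4\<close> exceed 13.
      The summand \<open>c\<close> makes the inequality strict for every \<open>r\<close>.\<close>
    moreover have "13 * real r * (real n * L) < 2 / 3 * ((c + 80 * real r) / 4 * (real n * L))"
    proof -
      have "13 * real r < 2 / 3 * ((c + 80 * real r) / 4)"
        using c by simp
      moreover have "0 < real n * L"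
        using n \<open>L \<ge> 1\<close> by simp
      ultimately show ?thesis
        by (metis mult.assoc mult_strict_right_mono)
    qed
    ultimately show "real t * ln (real n) * real s < real t * real d - real r * (2 * real n * real d / real s + real n)"
      using ts loss unfolding L_def by linarith
  qed
qed

text \<open>The exponents \<open>a\<close> and \<open>1 - 1 / k\<close> are reciprocal, so the bound
  on \<open>n\<close> inverts to one on \<open>n powr (1 - 1 / k)\<close>. Since
  \<open>a \<le> 2\<close>, also \<open>n \<le> t powr 2\<close>, so
  \<open>ln n \<le> 2 * ln t\<close>; the 2 in \<open>C\<close> cancels this factor.\<close>

lemma inverse_scale:
  fixes k t :: nat and K C :: real
  defines "a \<equiv> real k / (real k - 1)"
  assumes k: "k \<ge> 2" and K: "K \<ge> 1" and C: "C = (1 / (2 * K)) powr a"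
    and t: "t \<ge> 3" "n \<ge> 1" and n: "real n \<le> C * (real t / ln (real t)) powr a"
  shows "K * real n powr (1 - 1 / real k) * ln (real n) \<le> real t"
proof -
  define x where "x = real t / ln (real t)"
  define b where "b = 1 - 1 / real k"
  have ab: "a * b = 1" "a \<le> 2" "a > 0" "b > 0"
    using k by (auto simp: a_def b_def field_simps)
  have "exp 1 \<le> real t"
    using exp_le t by linarith
  then have ln: "ln (real t) \<ge> 1"
    using t by (simp add: ln_ge_iff)
  have "0 < x" "x \<le> real t"
    using t ln by (auto simp: x_def field_simps)
  have Cx: "C * x powr a = (x / (2 * K)) powr a"
    using C K \<open>0 < x\<close> by (simp add: powr_mult[symmetric])
  have "real n powr b \<le> ((x / (2 * K)) powr a) powr b"
    using n Cx ab by (intro powr_mono2) (auto simp: x_def)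
  also have "\<dots> = x / (2 * K)"
    using ab K \<open>0 < x\<close> by (simp add: powr_powr)
  finally have nb: "real n powr b \<le> x / (2 * K)" .
  have "real n \<le> (x / (2 * K)) powr a"
    using n Cx by (simp add: x_def)
  also have "\<dots> \<le> real t powr a"
  proof (rule powr_mono2)
    have "x / (2 * K) \<le> x / 1"
      using K \<open>0 < x\<close> by (intro divide_left_mono) auto
    with \<open>x \<le> real t\<close> show "x / (2 * K) \<le> real t" by simp
  qed (use ab K \<open>0 < x\<close> in auto)
  also have "\<dots> \<le> real t powr 2"
    using ab t by (intro powr_mono) auto
  finally have "ln (real n) \<le> ln (real t powr 2)"
    using t by (intro ln_mono) auto
  also have "\<dots> = 2 * ln (real t)"
    using t by (subst ln_powr) auto
  finally have lnn: "ln (real n) \<le> 2 * ln (real t)" .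
  have "K * real n powr b * ln (real n) \<le> K * (x / (2 * K)) * (2 * ln (real t))"
    using nb lnn K t ln \<open>0 < x\<close> by (intro mult_mono) auto
  also have "\<dots> = real t"
    using K ln by (simp add: x_def field_simps)
  finally show ?thesis
    by (simp add: b_def)
qed

text \<open>From \<open>ln t \<le> 2 * sqrt t\<close> follows
  \<open>t / ln t \<ge> sqrt t / 2\<close>. For \<open>t \<ge> 4\<close> this is at least 1, so the
  exponent, which is at least 1, may be replaced by 1.\<close>

lemma eventually_scale_ge:
  fixes k :: nat and C :: real
  assumes k: "k \<ge> 2" and C: "C > 0"
  shows "\<forall>\<^sub>F t :: nat in sequentially. B \<le> C * (real t / ln (real t)) powr (real k / (real k - 1))"
proof -
  define M where "M = nat \<lceil>(2 * \<bar>B\<bar> / C)\<^sup>2\<rceil> + nat \<lceil>4 :: real\<rceil> + 3"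
  have "B \<le> C * (real t / ln (real t)) powr (real k / (real k - 1))" if t: "t \<ge> M" for t
  proof -
    have "t \<ge> 4" and sq: "(2 * \<bar>B\<bar> / C)\<^sup>2 \<le> real t"
      using t unfolding M_def by linarith+
    have "ln (real t) > 0"
      using \<open>t \<ge> 4\<close> by simp
    have "ln (real t) \<le> real t powr (1 / 2) / (1 / 2)"
      using \<open>t \<ge> 4\<close> by (intro ln_powr_bound) auto
    then have "ln (real t) \<le> 2 * sqrt (real t)"
      by (simp add: powr_half_sqrt)
    then have "sqrt (real t) / 2 * ln (real t) \<le> sqrt (real t) / 2 * (2 * sqrt (real t))"
      by (intro mult_left_mono) auto
    then have x: "sqrt (real t) / 2 \<le> real t / ln (real t)"
      using \<open>ln (real t) > 0\<close> by (simp add: pos_le_divide_eq)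
    have "2 \<le> sqrt (real t)"
      using \<open>t \<ge> 4\<close> by (intro real_le_rsqrt) simp
    then have "1 \<le> real t / ln (real t)"
      using x by linarith
    have "2 * \<bar>B\<bar> / C \<le> sqrt (real t)"
      using sq by (rule real_le_rsqrt)
    then have "\<bar>B\<bar> \<le> C * (sqrt (real t) / 2)"
      using C by (simp add: field_simps)
    also have "\<dots> \<le> C * (real t / ln (real t)) powr 1"
      using x C \<open>ln (real t) > 0\<close> \<open>2 \<le> sqrt (real t)\<close> by (intro mult_left_mono) auto
    also have "\<dots> \<le> C * (real t / ln (real t)) powr (real k / (real k - 1))"
      using \<open>1 \<le> real t / ln (real t)\<close> C k
      by (intro mult_left_mono powr_mono) (simp_all add: pos_le_divide_eq)
    finally show ?thesis by linarith
  qed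
  then show ?thesis
    by (rule eventually_sequentiallyI)
qed

section \<open>The lower bound for the Ramsey number\<close>

text \<open>The Ramsey number is an infimum over all sizes with the required property, so each size
  up to \<open>n\<close> has to be ruled out by its own hypergraph.\<close>

lemma ramsey_number_greater:
  assumes "\<And>m. m \<le> n \<Longrightarrow> \<exists>(X :: nat set) H. uniform_hypergraph r X H \<and> card X = m \<and>
    \<not> contains_member H \<F> \<and> \<not> (\<exists>S. independent_set X H S \<and> card S = t)"
  shows "enat (Suc n) \<le> ramsey_number r t \<F>"
  unfolding ramsey_number_def
proof (rule Inf_greatest, clarify)
  fix m
  assume "\<forall>(V :: nat set) E. uniform_hypergraph r V E \<and> card V = m \<longrightarrow>
    contains_member E \<F> \<or> (\<exists>S. independent_set V E S \<and> card S = t)"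
  with assms have "\<not> m \<le> n" by blast
  then show "enat (Suc n) \<le> enat m" by simp
qed

theorem theorem2:
  fixes k r :: nat
  assumes "k \<ge> 2" and "r \<ge> 3"
    and "\<exists>c::real. c > 0 \<and>
           (\<forall>\<^sub>F n :: nat in sequentially. \<exists>(V :: nat set) E.
              uniform_hypergraph 2 V E \<and> card V = n \<and> girth E > enat (2 * k) \<and>
              real (card E) \<ge> c * real n powr (1 + 1 / real k))"
  shows "\<exists>C::real. C > 0 \<and>
           (\<forall>\<^sub>F t :: nat in sequentially.
              ereal_of_enat (ramsey_number r t (nontrivial_berge_cycles r k)) \<ge>
              ereal (C * (real t / ln (real t)) powr (real k / (real k - 1))))"
proof -
  obtain c :: real where c: "c > 0" and graphs: "\<forall>\<^sub>F n :: nat in sequentially. \<exists>(V :: nat set) E.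
      uniform_hypergraph 2 V E \<and> card V = n \<and> girth E > enat (2 * k) \<and>
      real (card E) \<ge> c * real n powr (1 + 1 / real k)"
    using assms(3) by blast
  have logs: "\<forall>\<^sub>F n :: nat in sequentially. ln (real n) \<le> (c / 12) * real n powr (1 / real k)"
    using assms(1) c by (intro eventually_ln_le_powr) auto
  have "\<forall>\<^sub>F n :: nat in sequentially. n \<ge> 3 \<and> 12 * ln (real n) \<le> c * real n powr (1 / real k) \<and>
      (\<exists>(V :: nat set) E. uniform_hypergraph 2 V E \<and> card V = n \<and> girth E > enat (2 * k) \<and>
        real (card E) \<ge> c * real n powr (1 + 1 / real k))"
    using eventually_ge_at_top[of 3] logs graphs by eventually_elim simp
  then obtain n0 where n0: "\<forall>n\<ge>n0. n \<ge> 3 \<and> 12 * ln (real n) \<le> c * real n powr (1 / real k) \<and>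
      (\<exists>(V :: nat set) E. uniform_hypergraph 2 V E \<and> card V = n \<and> girth E > enat (2 * k) \<and>
        real (card E) \<ge> c * real n powr (1 + 1 / real k))"
    unfolding eventually_sequentially by (rule exE)
  define K where "K = 1 + 80 * real r / c"
  define a where "a = real k / (real k - 1)"
  define C where "C = (1 / (2 * K)) powr a"
  have "K \<ge> 1"
    using c by (simp add: K_def)
  then have "C > 0"
    by (simp add: C_def)
  have bound: "ereal (C * (real t / ln (real t)) powr a) \<le> ereal_of_enat (ramsey_number r t (nontrivial_berge_cycles r k))"
    if t: "t \<ge> 3" and large: "real (Suc n0) \<le> C * (real t / ln (real t)) powr a" for t
  proof -
    \<comment> \<open>Rounding down costs nothing, because the Ramsey number is at least
      \<open>Suc n\<close>. The assumption \<open>large\<close> puts \<open>n\<close> beyond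
      \<open>n0\<close>, where the graphs exist.\<close>
    define n where "n = nat \<lfloor>C * (real t / ln (real t)) powr a\<rfloor>"
    have n: "n0 \<le> n" "1 \<le> n" "real n \<le> C * (real t / ln (real t)) powr a"
      "C * (real t / ln (real t)) powr a \<le> real (Suc n)"
      using large unfolding n_def by linarith+
    from n0 n(1) have n': "n \<ge> 3" "12 * ln (real n) \<le> c * real n powr (1 / real k)"
      by auto
    from n0 n(1) obtain V :: "nat set" and E where G: "uniform_hypergraph 2 V E" "card V = n"
      "girth E > enat (2 * k)" "real (card E) \<ge> c * real n powr (1 + 1 / real k)"
      by blast
    \<comment> \<open>The choice of \<open>C\<close> turns the upper bound on \<open>n\<close> into
      the lower bound on \<open>t\<close> under which \<open>d\<close> and \<open>s\<close>
      exist.\<close>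
    have "K * real n powr (1 - 1 / real k) * ln (real n) \<le> real t"
      using assms(1) \<open>K \<ge> 1\<close> t n by (intro inverse_scale[where C = C]) (auto simp: C_def a_def)
    then obtain d s where ds: "d > 0" "s > 0"
      "2 * real n * real d \<le> c * real n powr (1 + 1 / real k)"
      "real t * ln (real n) * real s < real t * real d - real r * (2 * real n * real d / real s + real n)"
      using parameter_choice[OF c _ n', of r t] assms(1) unfolding K_def by auto
    have "real (2 * n * d) \<le> real (card E)"
      using ds(3) G(4) by simp
    then have "2 * n * d \<le> card E"
      by (simp only: of_nat_le_iff)
    then have "\<exists>(X :: nat set) H. uniform_hypergraph r X H \<and> card X = m \<and>
        \<not> contains_member H (nontrivial_berge_cycles r k) \<and>
        \<not> (\<exists>S. independent_set X H S \<and> card S = t)" if "m \<le> n" for m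
      using assms n(2) that ds by (intro hypergraph_of_graph[OF G(1-3)]) auto
    then have "enat (Suc n) \<le> ramsey_number r t (nontrivial_berge_cycles r k)"
      by (rule ramsey_number_greater)
    then have "ereal_of_enat (enat (Suc n)) \<le> ereal_of_enat (ramsey_number r t (nontrivial_berge_cycles r k))"
      by (simp only: ereal_of_enat_le_iff)
    moreover have "ereal (C * (real t / ln (real t)) powr a) \<le> ereal_of_enat (enat (Suc n))"
      using n(4) by simp
    ultimately show ?thesis
      by (rule order_trans[rotated])
  qed
  have "\<forall>\<^sub>F t :: nat in sequentially. real (Suc n0) \<le> C * (real t / ln (real t)) powr a"
    unfolding a_def using assms(1) \<open>C > 0\<close> by (rule eventually_scale_ge)
  then have "\<forall>\<^sub>F t :: nat in sequentially.
      ereal (C * (real t / ln (real t)) powr a) \<le> ereal_of_enat (ramsey_number r t (nontrivial_berge_cycles r k))"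
    using eventually_ge_at_top[of 3] by eventually_elim (rule bound)
  with \<open>C > 0\<close> show ?thesis
    unfolding a_def by blast
qed

end
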